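(* Let $K\subset\mathbb{R}^2$ be a compact body and let $\mu$ be a measure on $(K,\mathcal{B}(K))$ with $\mu(K)<\infty$ such that $\mu(\{(\alpha,\beta)\in K:\alpha=x\})=0=\mu(\{(\alpha,\beta)\in K:\beta=y\})$ for all $x,y\in\mathbb{R}$. Then a point $(x,y)\in\mathbb{R}^2$ is a global minimizer of the generalized conic function $F_{K,\mu}$ if and only if it bisects the $\mu$-area of $K$, i.e., the vertical and the horizontal lines through $(x,y)$ each cut $K$ into two parts of equal $\mu$-measure: $$\mu(\{(\alpha,\beta)\in K:\alpha<x\})=\mu(\{(\alpha,\beta)\in K:x<\alpha\})\quad\text{and}\quad \mu(\{(\alpha,\beta)\in K:\beta<y\})=\mu(\{(\alpha,\beta)\in K:y<\beta\}).$$ Moreover, if in addition $K$ is connected and $\mu(B(p,\varepsilon)\cap K)>0$ for all $p\in K$ and $\varepsilon>0$, then the convex function $F_{K,\mu}$ has a unique global minimizer $(x^*,y^* )\in\mathbb{R}^2$, that is, $F_{K,\mu}(x,y)>F_{K,\mu}(x^*,y^* )$ for all $(x,y)\in\mathbb{R}^2$ with $(x,y)\neq(x^*,y^* )$.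
   Context: A compact body in $\mathbb{R}^2$ is a non-empty compact set that coincides with the closure of its interior. $\mathcal{B}(K)$ is the Borel $\sigma$-algebra on $K$, and $B(p,\varepsilon)$ is the open Euclidean ball around $p$ with radius $\varepsilon$. The generalized conic function associated with $K$ and $\mu$ is $F_{K,\mu}:\mathbb{R}^2\to\mathbb{R}$, $$F_{K,\mu}(x,y):=\int_K\big(|x-\alpha|+|y-\beta|\big)\,\mu(d\alpha,d\beta).$$ *)

theory Defs
  imports "HOL-Analysis.Analysis"
begin

text \<open>
  The plane is \<^typ>\<open>real \<times> real\<close>, whose library metric is the Euclidean one.
\<close>

definition compact_body :: "(real \<times> real) set \<Rightarrow> bool" where
  "compact_body K \<longleftrightarrow> K \<noteq> {} \<and> compact K \<and> closure (interior K) = K"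

text \<open>
  The trace \<sigma>-algebra of the Borel sets on \<open>K\<close> is the Borel \<sigma>-algebra of the subspace \<open>K\<close>;
  equality of the \<sigma>-algebras also forces the underlying space of \<open>\<mu>\<close> to be \<open>K\<close>.
\<close>

definition finite_borel_measure_on :: "(real \<times> real) set \<Rightarrow> (real \<times> real) measure \<Rightarrow> bool" where
  "finite_borel_measure_on K \<mu> \<longleftrightarrow>
     sets \<mu> = sets (restrict_space borel K) \<and> emeasure \<mu> K < \<infinity>"

definition generalized_conic ::
  "(real \<times> real) set \<Rightarrow> (real \<times> real) measure \<Rightarrow> real \<times> real \<Rightarrow> real" where
  "generalized_conic K \<mu> = (\<lambda>(x, y). LINT (\<alpha>, \<beta>):K|\<mu>. \<bar>x - \<alpha>\<bar> + \<bar>y - \<beta>\<bar>)"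

definition global_minimizer :: "(real \<times> real \<Rightarrow> real) \<Rightarrow> real \<times> real \<Rightarrow> bool" where
  "global_minimizer f p \<longleftrightarrow> (\<forall>q. f p \<le> f q)"

definition bisects_area ::
  "(real \<times> real) set \<Rightarrow> (real \<times> real) measure \<Rightarrow> real \<times> real \<Rightarrow> bool" where
  "bisects_area K \<mu> = (\<lambda>(x, y).
     emeasure \<mu> {(\<alpha>, \<beta>) \<in> K. \<alpha> < x} = emeasure \<mu> {(\<alpha>, \<beta>) \<in> K. x < \<alpha>} \<and>
     emeasure \<mu> {(\<alpha>, \<beta>) \<in> K. \<beta> < y} = emeasure \<mu> {(\<alpha>, \<beta>) \<in> K. y < \<beta>})"

end

theory Submission
  imports Defs
begin

text \<open>
  The integrand is a sum of a function of \<open>x\<close> and a function of \<open>y\<close>, so \<open>F\<^bsub>K,\<mu>\<^esub>\<close> splits as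
  \<open>G\<^sub>1 x + G\<^sub>2 y\<close>, where each summand has the form \<open>G x = \<integral> \<bar>x - X\<bar> d\<mu>\<close> with \<open>X\<close> a coordinate
  projection. Minimizing \<open>F\<close> therefore means minimizing both summands, and a minimizer of such
  a \<open>G\<close> is a median of \<open>X\<close>.

  To see the latter without differentiating under the integral, integrate the subgradient
  inequality \<open>\<bar>y - a\<bar> \<ge> \<bar>x - a\<bar> + (y - x) sgn (x - a)\<close>. It shows that
  \<open>D x = \<integral> sgn (x - X) d\<mu> = \<mu>{X < x} - \<mu>{X > x}\<close> is a subgradient of \<open>G\<close> at \<open>x\<close>, so a zero of
  \<open>D\<close> is a minimizer. Conversely, if \<open>x\<close> is a minimizer, then the subgradient inequality at nearby
  points gives \<open>D \<le> 0\<close> on the left of \<open>x\<close> and \<open>D \<ge> 0\<close> on the right; since vertical and horizontal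
  lines are null sets, \<open>D\<close> is continuous and hence \<open>D x = 0\<close>.

  A zero of \<open>D\<close> exists by the intermediate value theorem, because \<open>D\<close> is minus the total mass far
  to the left and the total mass far to the right. If there were two zeros \<open>x < x'\<close>, then the
  strip \<open>x < X < x'\<close> would be null. If every neighbourhood of every point of \<open>K\<close> has positive
  measure, this strip misses \<open>K\<close>; if \<open>K\<close> is also connected, it lies on one side of the strip, so
  that \<open>D\<close> is plus or minus the total mass at one of its two zeros, and \<open>\<mu>\<close> would vanish.
\<close>

section \<open>Integrated absolute deviation of an integrable function\<close>

lemma abs_diff_subgradient:
  fixes a x y :: real
  shows "\<bar>x - a\<bar> + (y - x) * sgn (x - a) \<le> \<bar>y - a\<bar>"
  by (auto simp: sgn_if abs_if)

locale integrable_function = finite_measure M for M :: "'a measure" +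
  fixes X :: "'a \<Rightarrow> real"
  assumes integrable_X: "integrable M X"
begin

definition abs_deviation :: "real \<Rightarrow> real" where
  "abs_deviation x = (LINT w|M. \<bar>x - X w\<bar>)"

definition mass_difference :: "real \<Rightarrow> real" where
  "mass_difference x = (LINT w|M. sgn (x - X w))"

lemma measurable_X [measurable]: "X \<in> borel_measurable M"
  using integrable_X by auto

lemma integrable_abs_deviation: "integrable M (\<lambda>w. \<bar>x - X w\<bar>)"
  using integrable_X by auto

lemma integrable_sgn: "integrable M (\<lambda>w. sgn (x - X w))"
  by (rule integrable_const_bound[where B = 1]) (auto simp: sgn_if)

lemma integrable_indicator_Collect:
  assumes "{w \<in> space M. P w} \<in> sets M"
  shows "integrable M (indicator {w \<in> space M. P w} :: 'a \<Rightarrow> real)"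
  using assms by (simp add: integrable_indicator_iff less_top[symmetric])

lemma mass_difference_eq:
  "mass_difference x = measure M {w \<in> space M. X w < x} - measure M {w \<in> space M. x < X w}"
proof -
  have "mass_difference x =
      (LINT w|M. indicator {w \<in> space M. X w < x} w - indicator {w \<in> space M. x < X w} w)"
    unfolding mass_difference_def
    by (rule Bochner_Integration.integral_cong) (auto simp: sgn_if indicator_def)
  also have "\<dots> = measure M {w \<in> space M. X w < x} - measure M {w \<in> space M. x < X w}"
    by (subst Bochner_Integration.integral_diff) (auto intro!: integrable_indicator_Collect)
  finally show ?thesis .
qed

text \<open>The pointwise subgradient inequality for the absolute value, integrated.\<close>

lemma abs_deviation_subgradient:
  "abs_deviation x + (y - x) * mass_difference x \<le> abs_deviation y"
proof -
  have "abs_deviation x + (y - x) * mass_difference x =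
      (LINT w|M. \<bar>x - X w\<bar> + (y - x) * sgn (x - X w))"
    unfolding abs_deviation_def mass_difference_def
    by (simp add: integrable_abs_deviation integrable_sgn)
  also have "\<dots> \<le> abs_deviation y"
    unfolding abs_deviation_def
    by (intro integral_mono Bochner_Integration.integrable_add integrable_mult_right
        integrable_abs_deviation integrable_sgn abs_diff_subgradient)
  finally show ?thesis .
qed

lemma convex_abs_deviation: "convex_on UNIV abs_deviation"
proof (rule convex_onI)
  fix t x y :: real
  assume t: "0 < t" "t < 1"
  define z where "z = (1 - t) * x + t * y"
  have "(1 - t) * (abs_deviation z + (x - z) * mass_difference z)
      + t * (abs_deviation z + (y - z) * mass_difference z)
      \<le> (1 - t) * abs_deviation x + t * abs_deviation y"
    using t by (intro add_mono mult_left_mono abs_deviation_subgradient) auto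
  \<comment> \<open>The weighted slope terms cancel because \<open>z\<close> is the weighted mean of \<open>x\<close> and \<open>y\<close>.\<close>
  moreover have "(1 - t) * (abs_deviation z + (x - z) * mass_difference z)
      + t * (abs_deviation z + (y - z) * mass_difference z) = abs_deviation z"
    unfolding z_def by (simp add: algebra_simps)
  ultimately show "abs_deviation ((1 - t) *\<^sub>R x + t *\<^sub>R y)
      \<le> (1 - t) * abs_deviation x + t * abs_deviation y"
    by (simp add: z_def)
qed simp

text \<open>
  For a fixed value \<open>a\<close> of \<open>X\<close>, the function \<open>x \<mapsto> sgn (x - a)\<close> jumps only at \<open>a\<close>. If the level
  set of \<open>X\<close> at the given point is null, almost every integrand is thus continuous there, and
  dominated convergence applies.
\<close>

lemma isCont_mass_difference:
  assumes "emeasure M {w \<in> space M. X w = x} = 0"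
  shows "isCont mass_difference x"
proof -
  have ae: "AE w in M. X w \<noteq> x"
    using assms by (auto simp: AE_iff_measurable[OF _ refl])
  show ?thesis
    unfolding continuous_at_sequentially comp_def mass_difference_def
  proof (intro allI impI)
    fix s assume s: "s \<longlonglongrightarrow> x"
    show "(\<lambda>n. LINT w|M. sgn (s n - X w)) \<longlonglongrightarrow> (LINT w|M. sgn (x - X w))"
    proof (rule integral_dominated_convergence[where w = "\<lambda>_. 1"])
      show "AE w in M. (\<lambda>n. sgn (s n - X w)) \<longlonglongrightarrow> sgn (x - X w)"
        using ae by eventually_elim (auto intro!: tendsto_intros s)
    qed (auto simp: sgn_if)
  qed
qed

lemma abs_deviation_minimal_if_mass_difference_0:
  assumes "mass_difference x = 0"
  shows "abs_deviation x \<le> abs_deviation y"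
  using abs_deviation_subgradient[of x y] assms by simp

text \<open>
  Only the nonstrict signs of the subgradient are known on either side of a minimizer;
  continuity transfers them to the minimizer itself.
\<close>

lemma mass_difference_0_if_minimal:
  assumes null: "emeasure M {w \<in> space M. X w = x} = 0"
    and minimal: "\<And>y. abs_deviation x \<le> abs_deviation y"
  shows "mass_difference x = 0"
proof (rule antisym)
  have sign: "0 \<le> (y - x) * mass_difference y" for y
    using abs_deviation_subgradient[of y x] minimal[of y] by (simp add: algebra_simps)
  have "(mass_difference \<longlongrightarrow> mass_difference x) (at x)"
    using isCont_mass_difference[OF null] by (simp add: isCont_def)
  then have left: "(mass_difference \<longlongrightarrow> mass_difference x) (at_left x)"
    and right: "(mass_difference \<longlongrightarrow> mass_difference x) (at_right x)"
    by (auto simp: filterlim_at_split)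
  have "\<forall>\<^sub>F y in at_left x. y < x"
    by (simp add: eventually_at_filter)
  then have "\<forall>\<^sub>F y in at_left x. mass_difference y \<le> 0"
  proof eventually_elim
    case (elim y)
    with sign[of y] show ?case by (auto simp: zero_le_mult_iff)
  qed
  with left show "mass_difference x \<le> 0"
    by (intro tendsto_upperbound) auto
  have "\<forall>\<^sub>F y in at_right x. x < y"
    by (simp add: eventually_at_filter)
  then have "\<forall>\<^sub>F y in at_right x. 0 \<le> mass_difference y"
  proof eventually_elim
    case (elim y)
    with sign[of y] show ?case by (auto simp: zero_le_mult_iff)
  qed
  with right show "0 \<le> mass_difference x"
    by (intro tendsto_lowerbound) auto
qed

section \<open>Existence and uniqueness of the median\<close>

lemma mass_difference_right:
  assumes "\<And>w. w \<in> space M \<Longrightarrow> X w < x"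
  shows "mass_difference x = measure M (space M)"
proof -
  have all: "{w \<in> space M. X w < x} = space M" and none: "{w \<in> space M. x < X w} = {}"
    using assms by force+
  show ?thesis unfolding mass_difference_eq all none by simp
qed

lemma mass_difference_left:
  assumes "\<And>w. w \<in> space M \<Longrightarrow> x < X w"
  shows "mass_difference x = - measure M (space M)"
proof -
  have all: "{w \<in> space M. x < X w} = space M" and none: "{w \<in> space M. X w < x} = {}"
    using assms by force+
  show ?thesis unfolding mass_difference_eq all none by simp
qed

lemma exists_mass_difference_0:
  assumes null: "\<And>x. emeasure M {w \<in> space M. X w = x} = 0"
    and bound: "\<And>w. w \<in> space M \<Longrightarrow> \<bar>X w\<bar> \<le> B"
  shows "\<exists>x. mass_difference x = 0"
proof -
  have right: "mass_difference (\<bar>B\<bar> + 1) = measure M (space M)"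
    by (rule mass_difference_right) (use bound in force)
  have left: "mass_difference (- \<bar>B\<bar> - 1) = - measure M (space M)"
    by (rule mass_difference_left) (use bound in force)
  have "\<exists>x. - \<bar>B\<bar> - 1 \<le> x \<and> x \<le> \<bar>B\<bar> + 1 \<and> mass_difference x = 0"
    by (rule IVT) (auto simp: left right intro: isCont_mass_difference null)
  then show ?thesis by blast
qed

text \<open>Passing from \<open>x\<close> to \<open>y\<close> moves the mass of the open strip from one side to the other.\<close>

lemma mass_difference_strip:
  assumes "x < y"
  shows "mass_difference x + 2 * measure M {w \<in> space M. x < X w \<and> X w < y}
    \<le> mass_difference y"
proof -
  let ?S = "{w \<in> space M. x < X w \<and> X w < y}"
  have S: "integrable M (indicator ?S :: 'a \<Rightarrow> real)"
    by (rule integrable_indicator_Collect) measurable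
  have "mass_difference x + 2 * measure M ?S = (LINT w|M. sgn (x - X w) + 2 * indicator ?S w)"
    unfolding mass_difference_def using S by (simp add: integrable_sgn)
  also have "\<dots> \<le> mass_difference y"
    unfolding mass_difference_def
  proof (rule integral_mono)
    show "integrable M (\<lambda>w. sgn (x - X w) + 2 * indicator ?S w)"
      using S by (simp add: integrable_sgn)
    show "sgn (x - X w) + 2 * indicator ?S w \<le> sgn (y - X w)" if "w \<in> space M" for w
      using assms that by (auto simp: sgn_if indicator_def)
  qed (rule integrable_sgn)
  finally show ?thesis .
qed

text \<open>
  Here \<open>charged\<close> says that the range of \<open>X\<close> lies in the support of its distribution. Together
  with connectedness it forbids a gap in the distribution that has mass on both sides.
\<close>

lemma mass_difference_0_unique:
  assumes "connected (X ` space M)"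
    and "space M \<noteq> {}"
    and charged: "\<And>u v w. w \<in> space M \<Longrightarrow> u < X w \<Longrightarrow> X w < v \<Longrightarrow>
      0 < measure M {w \<in> space M. u < X w \<and> X w < v}"
    and "mass_difference x = 0" and "mass_difference y = 0"
  shows "x = y"
proof -
  have mass: "0 < measure M (space M)"
  proof -
    obtain w where "w \<in> space M" using assms(2) by blast
    then have "0 < measure M {w' \<in> space M. X w - 1 < X w' \<and> X w' < X w + 1}"
      by (intro charged) auto
    also have "\<dots> \<le> measure M (space M)" by (rule bounded_measure)
    finally show ?thesis .
  qed
  have no_gap: False if "u < v" "mass_difference u = 0" "mass_difference v = 0" for u v
  proof -
    have "measure M {w \<in> space M. u < X w \<and> X w < v} \<le> 0"
      using mass_difference_strip[of u v] that by simp
    then have outside: "X w \<le> u \<or> v \<le> X w" if "w \<in> space M" for w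
      using charged[OF that, of u v] by force
    define m where "m = (u + v) / 2"
    have "m \<notin> X ` space M"
      using outside \<open>u < v\<close> by (force simp: m_def)
    then have "\<not> (X w \<le> m \<and> m \<le> X w')" if "w \<in> space M" "w' \<in> space M" for w w'
      using connectedD_interval[OF assms(1), of "X w" "X w'" m] that by blast
    then have "(\<forall>w\<in>space M. X w < m) \<or> (\<forall>w\<in>space M. m < X w)"
      by (meson not_less)
    then show False
    proof
      assume "\<forall>w\<in>space M. X w < m"
      then have "mass_difference v = measure M (space M)"
        using \<open>u < v\<close> by (intro mass_difference_right) (force simp: m_def)
      with that mass show False by simp
    next
      assume "\<forall>w\<in>space M. m < X w"
      then have "mass_difference u = - measure M (space M)"
        using \<open>u < v\<close> by (intro mass_difference_left) (force simp: m_def)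
      with that mass show False by simp
    qed
  qed
  with assms(4,5) show ?thesis by (meson linorder_neqE_linordered_idom)
qed

end

section \<open>Generalized conics in the plane\<close>

lemma integrable_function_on_compact:
  assumes "finite_borel_measure_on K \<mu>" and "compact K" and "continuous_on UNIV f"
  shows "integrable_function \<mu> f"
proof -
  have sets: "sets \<mu> = sets (restrict_space borel K)"
    using assms(1) by (simp add: finite_borel_measure_on_def)
  have space: "space \<mu> = K"
    using sets_eq_imp_space_eq[OF sets] by (simp add: space_restrict_space)
  interpret finite_measure \<mu>
    using assms(1) by (intro finite_measureI) (auto simp: finite_borel_measure_on_def space)
  have "f \<in> borel_measurable \<mu>"
    unfolding measurable_cong_sets[OF sets refl]
    by (intro measurable_restrict_space1 borel_measurable_continuous_onI assms(3))
  moreover have "bounded (f ` K)"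
    using assms(2,3) by (intro compact_imp_bounded compact_continuous_image)
      (auto intro: continuous_on_subset)
  then obtain B where "\<And>w. w \<in> K \<Longrightarrow> norm (f w) \<le> B"
    by (auto simp: bounded_iff)
  ultimately show ?thesis
    by unfold_locales (auto intro!: integrable_const_bound[where B = B] simp: space)
qed

text \<open>
  The strip \<open>u < f < v\<close> is open in the plane, so with a point of \<open>K\<close> it contains a ball around
  this point, and the part of the ball in \<open>K\<close> already has positive measure.
\<close>

lemma measure_open_strip_pos:
  fixes f :: "real \<times> real \<Rightarrow> real"
  assumes \<mu>: "finite_borel_measure_on K \<mu>" and "compact K" and f: "continuous_on UNIV f"
    and charged: "\<And>p \<epsilon>. p \<in> K \<Longrightarrow> 0 < \<epsilon> \<Longrightarrow> 0 < emeasure \<mu> (ball p \<epsilon> \<inter> K)"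
    and w: "w \<in> K" "u < f w" "f w < v"
  shows "0 < measure \<mu> {w \<in> K. u < f w \<and> f w < v}"
proof -
  interpret integrable_function \<mu> f
    by (rule integrable_function_on_compact) fact+
  have sets: "sets \<mu> = sets (restrict_space borel K)"
    using \<mu> by (simp add: finite_borel_measure_on_def)
  have space: "space \<mu> = K"
    using sets_eq_imp_space_eq[OF sets] by (simp add: space_restrict_space)
  have "open {w. u < f w \<and> f w < v}"
    using f by (intro open_Collect_conj open_Collect_less continuous_intros)
  then obtain \<epsilon> where \<epsilon>: "0 < \<epsilon>" "ball w \<epsilon> \<subseteq> {w. u < f w \<and> f w < v}"
    using w by (auto elim!: openE)
  have "0 < emeasure \<mu> (ball w \<epsilon> \<inter> K)"
    using charged w(1) \<epsilon>(1) by blast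
  also have "\<dots> \<le> emeasure \<mu> {w \<in> space \<mu>. u < f w \<and> f w < v}"
    by (rule emeasure_mono) (use \<epsilon>(2) space in auto)
  finally show ?thesis
    by (simp add: emeasure_eq_measure space)
qed

theorem corollary2p1:
  fixes K :: "(real \<times> real) set" and \<mu> :: "(real \<times> real) measure"
  assumes "compact_body K"
    and "finite_borel_measure_on K \<mu>"
    and "\<And>x. emeasure \<mu> {(\<alpha>, \<beta>) \<in> K. \<alpha> = x} = 0"
    and "\<And>y. emeasure \<mu> {(\<alpha>, \<beta>) \<in> K. \<beta> = y} = 0"
  shows "(\<forall>x y. global_minimizer (generalized_conic K \<mu>) (x, y) \<longleftrightarrow> bisects_area K \<mu> (x, y)) \<and>
    (connected K \<and> (\<forall>p\<in>K. \<forall>\<epsilon>>0. emeasure \<mu> (ball p \<epsilon> \<inter> K) > 0) \<longrightarrow>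
      convex_on UNIV (generalized_conic K \<mu>) \<and>
      (\<exists>xs ys. \<forall>x y. (x, y) \<noteq> (xs, ys) \<longrightarrow>
        generalized_conic K \<mu> (x, y) > generalized_conic K \<mu> (xs, ys)))"
proof -
  have K: "compact K" "K \<noteq> {}"
    using assms(1) by (auto simp: compact_body_def)
  have cont: "continuous_on UNIV (fst :: real \<times> real \<Rightarrow> real)"
    "continuous_on UNIV (snd :: real \<times> real \<Rightarrow> real)"
    by (auto intro: continuous_intros)
  interpret fst: integrable_function \<mu> fst
    by (rule integrable_function_on_compact) fact+
  interpret snd: integrable_function \<mu> snd
    by (rule integrable_function_on_compact) fact+
  have sets: "sets \<mu> = sets (restrict_space borel K)"
    using assms(2) by (simp add: finite_borel_measure_on_def)
  have space: "space \<mu> = K"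
    using sets_eq_imp_space_eq[OF sets] by (simp add: space_restrict_space)
  have null: "emeasure \<mu> {w \<in> space \<mu>. fst w = x} = 0" "emeasure \<mu> {w \<in> space \<mu>. snd w = x} = 0" for x
    using assms(3,4)[of x] by (simp_all add: space case_prod_beta')

  have conic: "generalized_conic K \<mu> (x, y) = fst.abs_deviation x + snd.abs_deviation y" for x y
  proof -
    have "generalized_conic K \<mu> (x, y) = (LINT w|\<mu>. \<bar>x - fst w\<bar> + \<bar>y - snd w\<bar>)"
      unfolding generalized_conic_def set_lebesgue_integral_def prod.case
      by (rule Bochner_Integration.integral_cong) (auto simp: space case_prod_beta')
    then show ?thesis
      by (simp add: fst.abs_deviation_def snd.abs_deviation_def
          fst.integrable_abs_deviation snd.integrable_abs_deviation)
  qed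
  have bisects: "bisects_area K \<mu> (x, y) \<longleftrightarrow>
      fst.mass_difference x = 0 \<and> snd.mass_difference y = 0" for x y
    by (simp add: bisects_area_def fst.mass_difference_eq snd.mass_difference_eq space
        case_prod_beta' fst.emeasure_eq_measure)

  have minimizer: "global_minimizer (generalized_conic K \<mu>) (x, y) \<longleftrightarrow> bisects_area K \<mu> (x, y)" for x y
  proof
    assume "bisects_area K \<mu> (x, y)"
    then show "global_minimizer (generalized_conic K \<mu>) (x, y)"
      unfolding global_minimizer_def bisects
      by (auto simp: conic intro!: add_mono fst.abs_deviation_minimal_if_mass_difference_0
          snd.abs_deviation_minimal_if_mass_difference_0)
  next
    assume "global_minimizer (generalized_conic K \<mu>) (x, y)"
    then have min: "fst.abs_deviation x + snd.abs_deviation y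
        \<le> fst.abs_deviation x' + snd.abs_deviation y'" for x' y'
      by (simp add: global_minimizer_def conic)
    have "fst.mass_difference x = 0"
      using min[of _ y] by (intro fst.mass_difference_0_if_minimal null) simp
    moreover have "snd.mass_difference y = 0"
      using min[of x] by (intro snd.mass_difference_0_if_minimal null) simp
    ultimately show "bisects_area K \<mu> (x, y)" by (simp add: bisects)
  qed

  have convex: "convex_on UNIV (generalized_conic K \<mu>)"
  proof (rule convex_onI)
    fix t :: real and p q :: "real \<times> real"
    assume t: "0 < t" "t < 1"
    show "generalized_conic K \<mu> ((1 - t) *\<^sub>R p + t *\<^sub>R q)
        \<le> (1 - t) * generalized_conic K \<mu> p + t * generalized_conic K \<mu> q"
      using convex_onD[OF fst.convex_abs_deviation, of t "fst p" "fst q"]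
        convex_onD[OF snd.convex_abs_deviation, of t "snd p" "snd q"] t
      by (cases p; cases q) (simp add: conic algebra_simps)
  qed simp

  have unique: "\<exists>xs ys. \<forall>x y. (x, y) \<noteq> (xs, ys) \<longrightarrow>
      generalized_conic K \<mu> (x, y) > generalized_conic K \<mu> (xs, ys)"
    if conn: "connected K" and charged: "\<forall>p\<in>K. \<forall>\<epsilon>>0. emeasure \<mu> (ball p \<epsilon> \<inter> K) > 0"
  proof -
    obtain B where B: "\<And>w. w \<in> K \<Longrightarrow> norm w \<le> B"
      using compact_imp_bounded[OF K(1)] by (auto simp: bounded_iff)
    obtain xs where xs: "fst.mass_difference xs = 0"
      using fst.exists_mass_difference_0[OF null(1), of B] B norm_fst_le space
      by (metis order_trans prod.collapse real_norm_def)
    obtain ys where ys: "snd.mass_difference ys = 0"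
      using snd.exists_mass_difference_0[OF null(2), of B] B norm_snd_le space
      by (metis order_trans prod.collapse real_norm_def)
    have fst_unique: "x = xs" if "fst.mass_difference x = 0" for x
    proof (rule fst.mass_difference_0_unique)
      show "connected (fst ` space \<mu>)"
        unfolding space by (intro connected_continuous_image conn continuous_intros)
      show "0 < measure \<mu> {w \<in> space \<mu>. u < fst w \<and> fst w < v}"
        if "w \<in> space \<mu>" "u < fst w" "fst w < v" for u v w
        using measure_open_strip_pos[OF assms(2) K(1) cont(1), of w u v] charged that
        by (simp add: space)
    qed (use K space xs that in auto)
    have snd_unique: "y = ys" if "snd.mass_difference y = 0" for y
    proof (rule snd.mass_difference_0_unique)
      show "connected (snd ` space \<mu>)"
        unfolding space by (intro connected_continuous_image conn continuous_intros)
      show "0 < measure \<mu> {w \<in> space \<mu>. u < snd w \<and> snd w < v}"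
        if "w \<in> space \<mu>" "u < snd w" "snd w < v" for u v w
        using measure_open_strip_pos[OF assms(2) K(1) cont(2), of w u v] charged that
        by (simp add: space)
    qed (use K space ys that in auto)
    have min: "global_minimizer (generalized_conic K \<mu>) (xs, ys)"
      by (simp add: minimizer bisects xs ys)
    \<comment> \<open>A point whose value does not exceed the minimum is a minimizer, hence a bisecting point.\<close>
    have "generalized_conic K \<mu> (x, y) > generalized_conic K \<mu> (xs, ys)"
      if "(x, y) \<noteq> (xs, ys)" for x y
    proof (rule ccontr)
      assume "\<not> ?thesis"
      with min have "global_minimizer (generalized_conic K \<mu>) (x, y)"
        unfolding global_minimizer_def by (meson not_less order_trans)
      then have "x = xs" "y = ys"
        by (auto simp: minimizer bisects intro: fst_unique snd_unique)
      with that show False by simp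
    qed
    then show ?thesis by blast
  qed
  show ?thesis
    using minimizer convex unique by blast
qed

end
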